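(* Let $r$ be a positive integer. Take any 2-colouring of the edges of $\vec{K}_{\mathbb{N}}$ (with colours red and blue) that does not contain a red directed path of length $r$. Then there exists a blue directed path in $\vec{K}_{\mathbb{N}}$ with upper density at least $\frac{1}{r}$.
   Context: $\mathbb{N}$ denotes the set of positive integers. $\vec{K}_{\mathbb{N}}$ is the complete symmetric digraph on $\mathbb{N}$: its vertex set is $\mathbb{N}$ and for every pair of distinct $m,n\in\mathbb{N}$ both directed edges $(m,n)$ (from $m$ to $n$) and $(n,m)$ are present. A $k$-colouring of $\vec{K}_{\mathbb{N}}$ is an assignment of one of $k$ colours to each directed edge (so $(m,n)$ and $(n,m)$ may receive different colours); in a 2-colouring the colours are red and blue. A path $P=v_1v_2\dots$ in $\vec{K}_{\mathbb{N}}$ is a finite or (one-way) infinite sequence of distinct vertices together with, for each pair of consecutive vertices, one of the two directed edges joining them. $P$ is a directed path if all its edges are oriented in the same direction along $P$. The length of a path is its number of edges. A path is red (respectively blue) if all of its edges are red (respectively blue). The upper density of a set $A\subseteq\mathbb{N}$ is $\bar d(A)=\limsup_{n\to\infty}\frac{|A\cap\{1,\dots,n\}|}{n}$, and the upper density of a path is the upper density of its vertex set. *)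

theory Defs
  imports Complex_Main "HOL-Library.Extended_Nat" "HOL-Library.Extended_Real"
    "HOL-Library.Liminf_Limsup"
begin

text \<open>The complete symmetric digraph on the positive integers.\<close>

definition K_verts :: "nat set" where
  "K_verts = {n. 0 < n}"

definition K_edges :: "(nat \<times> nat) set" where
  "K_edges = {(m, n). m \<in> K_verts \<and> n \<in> K_verts \<and> m \<noteq> n}"

text \<open>A 2-colouring is a function on pairs; only its values on \<open>K_edges\<close> are ever used.\<close>

datatype colour = Red | Blue

text \<open>
  A path with \<open>len\<close> edges, where \<open>len = \<infinity>\<close> encodes a one-way infinite path.  Its vertices are
  \<open>vertex i\<close> for \<open>i \<le> len\<close>, and its \<open>i\<close>-th edge, for \<open>i < len\<close>, joins \<open>vertex i\<close> and
  \<open>vertex (i + 1)\<close>, starting at \<open>vertex i\<close> iff \<open>forward i\<close>.  Values of \<open>vertex\<close> and \<open>forward\<close>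
  at other indices are irrelevant.
\<close>

record kpath =
  len :: enat
  vertex :: "nat \<Rightarrow> nat"
  forward :: "nat \<Rightarrow> bool"

definition path_verts :: "kpath \<Rightarrow> nat set" where
  "path_verts P = vertex P ` {i. enat i \<le> len P}"

definition path_edge :: "kpath \<Rightarrow> nat \<Rightarrow> nat \<times> nat" where
  "path_edge P i =
     (if forward P i then (vertex P i, vertex P (Suc i)) else (vertex P (Suc i), vertex P i))"

definition path_edges :: "kpath \<Rightarrow> (nat \<times> nat) set" where
  "path_edges P = path_edge P ` {i. enat i < len P}"

definition is_path :: "kpath \<Rightarrow> bool" where
  "is_path P \<longleftrightarrow>
     inj_on (vertex P) {i. enat i \<le> len P} \<and> path_verts P \<subseteq> K_verts \<and> path_edges P \<subseteq> K_edges"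

text \<open>
  All edges point away from the first vertex, or all point towards it; for an infinite path these
  are genuinely different possibilities.
\<close>

definition is_directed_path :: "kpath \<Rightarrow> bool" where
  "is_directed_path P \<longleftrightarrow> is_path P \<and>
     ((\<forall>i. enat i < len P \<longrightarrow> forward P i) \<or> (\<forall>i. enat i < len P \<longrightarrow> \<not> forward P i))"

definition has_colour :: "(nat \<times> nat \<Rightarrow> colour) \<Rightarrow> colour \<Rightarrow> kpath \<Rightarrow> bool" where
  "has_colour c k P \<longleftrightarrow> (\<forall>e \<in> path_edges P. c e = k)"

definition upper_density :: "nat set \<Rightarrow> ereal" where
  "upper_density A = limsup (\<lambda>n. ereal (real (card (A \<inter> {1..n})) / real n))"

end

theory Submission
  imports Defs "HOL-Library.Infinite_Set"
begin

text \<open>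
  The red edges form a digraph without a directed path of length \<open>r\<close>.  By the Gallai--Roy theorem,
  which holds for infinite digraphs too (\<open>gallai_roy\<close>), its vertices can be properly coloured with
  \<open>r\<close> colours.  Within one colour class no edge is red, so all edges in both directions are blue.
  Since the \<open>r\<close> classes cover the positive integers, one of them has upper density at least
  \<open>1 / r\<close> (\<open>upper_density_pigeonhole\<close>).  That class is infinite, and listing its elements in any
  order, for instance increasingly, gives a blue directed path through all of them.
\<close>

lemma trancl_Union_chain:
  assumes "subset.chain S C" and "(x, y) \<in> (\<Union>C)\<^sup>+"
  shows "\<exists>R\<in>C. (x, y) \<in> R\<^sup>+"
  using assms(2)
proof (induction rule: trancl_induct)
  case (base y)
  then show ?case by blast
next
  case (step y z)
  then obtain R T where RT: "R \<in> C" "(x, y) \<in> R\<^sup>+" "T \<in> C" "(y, z) \<in> T"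
    by blast
  then have "R \<subseteq> T \<or> T \<subseteq> R"
    using assms(1) unfolding subset.chain_def by blast
  then show ?case
  proof
    assume "R \<subseteq> T"
    then have "(x, y) \<in> T\<^sup>+" using RT(2) trancl_mono by blast
    then have "(x, z) \<in> T\<^sup>+" using RT(4) by (rule trancl_into_trancl)
    then show ?thesis using RT(3) by blast
  next
    assume "T \<subseteq> R"
    then have "(y, z) \<in> R" using RT(4) by blast
    with RT(2) have "(x, z) \<in> R\<^sup>+" by (rule trancl_into_trancl)
    then show ?thesis using RT(1) by blast
  qed
qed

text \<open>
  Zorn's lemma applies because a cycle uses only finitely many edges, so a cycle in the union of a
  chain already lies in one member of the chain.
\<close>

lemma maximal_acyclic_subrelation:
  "\<exists>R. R \<subseteq> E \<and> acyclic R \<and> (\<forall>S. R \<subseteq> S \<longrightarrow> S \<subseteq> E \<longrightarrow> acyclic S \<longrightarrow> S = R)"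
proof -
  let ?A = "{R. R \<subseteq> E \<and> acyclic R}"
  have "\<exists>U\<in>?A. \<forall>X\<in>C. X \<subseteq> U" if C: "subset.chain ?A C" for C
  proof -
    have sub: "C \<subseteq> ?A" using C unfolding subset.chain_def by blast
    have "acyclic (\<Union>C)"
      unfolding acyclic_def
    proof
      fix x
      show "(x, x) \<notin> (\<Union>C)\<^sup>+"
      proof
        assume "(x, x) \<in> (\<Union>C)\<^sup>+"
        then obtain S where "S \<in> C" "(x, x) \<in> S\<^sup>+"
          using trancl_Union_chain[OF C] by blast
        then show False using sub unfolding acyclic_def by blast
      qed
    qed
    then have "\<Union>C \<in> ?A" using sub by blast
    then show ?thesis by blast
  qed
  then have "\<exists>R\<in>?A. \<forall>X\<in>?A. R \<subseteq> X \<longrightarrow> X = R" by (rule subset_Zorn)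
  then obtain R where "R \<subseteq> E" "acyclic R" and "\<forall>X\<in>?A. R \<subseteq> X \<longrightarrow> X = R" by blast
  then show ?thesis by (intro exI[of _ R]) auto
qed

lemma acyclic_walk_inj_on:
  assumes "acyclic R" and "\<And>i. i < n \<Longrightarrow> (p i, p (Suc i)) \<in> R"
  shows "inj_on p {..n}"
proof -
  have walk: "j \<le> n \<Longrightarrow> (p i, p j) \<in> R\<^sup>+" if "i < j" for i j
    using that
  proof (induction rule: strict_inc_induct[where j = j])
    case (base i)
    then show ?case using assms(2)[of i] by auto
  next
    case (step i)
    then have "(p i, p (Suc i)) \<in> R" using assms(2)[of i] by simp
    then show ?case using step by (meson trancl_into_trancl2)
  qed
  have "p i \<noteq> p j" if "j \<le> n" "i < j" for i j
    using walk[OF that(2,1)] assms(1) unfolding acyclic_def by metis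
  then show ?thesis by (intro linorder_inj_onI') simp
qed

text \<open>
  In a maximal acyclic subrelation \<open>R\<close>, colour a vertex by the greatest length of an \<open>R\<close>-walk ending
  there.  Walks in \<open>R\<close> do not repeat vertices, so these lengths stay below \<open>r\<close>.  An edge of \<open>R\<close>
  increases the colour.  An edge of \<open>E\<close> outside \<open>R\<close>, other than a loop, closes a cycle with an
  \<open>R\<close>-walk from its head to its tail by maximality, so it decreases the colour.
\<close>

lemma gallai_roy:
  fixes E :: "('a \<times> 'a) set"
  assumes no_path: "\<not> (\<exists>p. inj_on p {..r} \<and> (\<forall>i<r. (p i, p (Suc i)) \<in> E))"
  shows "\<exists>f :: 'a \<Rightarrow> nat. (\<forall>v. f v < r) \<and> (\<forall>u v. (u, v) \<in> E \<longrightarrow> u \<noteq> v \<longrightarrow> f u \<noteq> f v)"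
proof -
  obtain R where R: "R \<subseteq> E" "acyclic R"
    and maximal: "\<And>S. R \<subseteq> S \<Longrightarrow> S \<subseteq> E \<Longrightarrow> acyclic S \<Longrightarrow> S = R"
    using maximal_acyclic_subrelation[of E] by auto
  define L where "L v = {n. \<exists>u. (u, v) \<in> R ^^ n}" for v
  define f where "f v = Max (L v)" for v
  have L_less: "n < r" if n: "n \<in> L v" for n v
  proof (rule ccontr)
    assume "\<not> n < r"
    moreover obtain p where p: "\<And>i. i < n \<Longrightarrow> (p i, p (Suc i)) \<in> R"
      using n unfolding L_def relpow_fun_conv by blast
    ultimately have *: "\<And>i. i < r \<Longrightarrow> (p i, p (Suc i)) \<in> R" by simp
    then have "inj_on p {..r}" by (rule acyclic_walk_inj_on[OF R(2)])
    then show False using no_path * R(1) by blast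
  qed
  have fin: "finite (L v)" for v
    using L_less by (intro finite_subset[of "L v" "{..<r}"]) auto
  have "0 \<in> L v" for v unfolding L_def by auto
  then have f_in: "f v \<in> L v" for v
    unfolding f_def using fin Max_in by blast
  have f_ge: "n \<le> f v" if "n \<in> L v" for n v
    unfolding f_def using fin that by (rule Max_ge)
  have increase: "f u < f v" if "(u, v) \<in> R\<^sup>+" for u v
    using that
  proof (induction rule: trancl_induct)
    case (base v)
    have "Suc (f u) \<in> L v"
      using f_in[of u] base unfolding L_def by (auto intro: relpow_Suc_I)
    from f_ge[OF this] show ?case by simp
  next
    case (step v w)
    have "Suc (f v) \<in> L w"
      using f_in[of v] step(2) unfolding L_def by (auto intro: relpow_Suc_I)
    from f_ge[OF this] show ?case using step by simp
  qed
  have "f u \<noteq> f v" if "(u, v) \<in> E" "u \<noteq> v" for u v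
  proof (cases "(u, v) \<in> R")
    case True
    then show ?thesis using increase[of u v] r_into_trancl by fastforce
  next
    case False
    then have "\<not> acyclic (insert (u, v) R)"
      using maximal[of "insert (u, v) R"] that(1) R(1) by blast
    then have "(v, u) \<in> R\<^sup>*" using R(2) by (simp add: acyclic_insert)
    then have "(v, u) \<in> R\<^sup>+" using that(2) by (auto simp: rtrancl_eq_or_trancl)
    then show ?thesis using increase[of v u] by auto
  qed
  then show ?thesis using L_less[OF f_in] by blast
qed

text \<open>
  If all the densities were below \<open>1 / card I\<close>, then for some \<open>n\<close> every class would contain fewer than
  \<open>n / card I\<close> of the numbers up to \<open>n\<close>, which is too few to cover them.
\<close>

lemma upper_density_pigeonhole:
  assumes "finite I" and "K_verts \<subseteq> (\<Union>i\<in>I. A i)"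
  shows "\<exists>i\<in>I. upper_density (A i) \<ge> ereal (1 / real (card I))"
proof (rule ccontr)
  assume "\<not> ?thesis"
  then have "\<forall>i\<in>I. \<forall>\<^sub>F n in sequentially.
      ereal (real (card (A i \<inter> {1..n})) / real n) < ereal (1 / real (card I))"
    unfolding upper_density_def not_le bex_simps by (intro ballI Limsup_lessD) blast
  then have "\<forall>\<^sub>F n in sequentially. \<forall>i\<in>I.
      ereal (real (card (A i \<inter> {1..n})) / real n) < ereal (1 / real (card I))"
    using assms(1) by (simp add: eventually_ball_finite_distrib)
  then have "\<forall>\<^sub>F n in sequentially. n > 0 \<and> (\<forall>i\<in>I.
      ereal (real (card (A i \<inter> {1..n})) / real n) < ereal (1 / real (card I)))"
    by (intro eventually_conj eventually_gt_at_top)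
  then obtain n where n: "n > 0"
    and small: "\<And>i. i \<in> I \<Longrightarrow> real (card (A i \<inter> {1..n})) / real n < 1 / real (card I)"
    by (auto dest: eventually_happens)
  have "I \<noteq> {}" using assms(2) unfolding K_verts_def by auto
  then have card_pos: "card I > 0" using assms(1) by (simp add: card_gt_0_iff)
  have "{1..n} \<subseteq> (\<Union>i\<in>I. A i \<inter> {1..n})" 
    using assms(2) unfolding K_verts_def by (auto simp: subset_iff Suc_le_eq)
  then have "n \<le> card (\<Union>i\<in>I. A i \<inter> {1..n})"
    using card_mono[of "\<Union>i\<in>I. A i \<inter> {1..n}" "{1..n}"] assms(1) by simp
  also have "\<dots> \<le> (\<Sum>i\<in>I. card (A i \<inter> {1..n}))"
    by (rule card_UN_le[OF assms(1)])
  finally have "real n \<le> (\<Sum>i\<in>I. real (card (A i \<inter> {1..n})))"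
    by (metis of_nat_le_iff of_nat_sum)
  also have "\<dots> < (\<Sum>i\<in>I. real n / real (card I))"
    using small n card_pos by (intro sum_strict_mono assms(1) \<open>I \<noteq> {}\<close>) (simp add: field_simps)
  also have "\<dots> = real n" using card_pos by simp
  finally show False by simp
qed

lemma upper_density_finite:
  assumes "finite A"
  shows "upper_density A = 0"
proof -
  have "(\<lambda>n. real (card (A \<inter> {1..n})) / real n) \<longlonglongrightarrow> 0"
  proof (rule tendsto_sandwich[where f = \<open>\<lambda>_. 0\<close>])
    show "(\<lambda>n. real (card A) / real n) \<longlonglongrightarrow> 0" by (rule lim_const_over_n)
    show "\<forall>\<^sub>F n in sequentially. real (card (A \<inter> {1..n})) / real n \<le> real (card A) / real n"
      using assms by (intro always_eventually allI divide_right_mono) (auto intro: card_mono)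
  qed auto
  then have "(\<lambda>n. ereal (real (card (A \<inter> {1..n})) / real n)) \<longlonglongrightarrow> ereal 0"
    by simp
  then show ?thesis
    unfolding upper_density_def zero_ereal_def by (intro lim_imp_Limsup) auto
qed

lemma infinite_clique_path:
  assumes "infinite A" and "A \<subseteq> K_verts"
    and clique: "\<And>u v. u \<in> A \<Longrightarrow> v \<in> A \<Longrightarrow> u \<noteq> v \<Longrightarrow> c (u, v) = k"
  shows "\<exists>P. is_directed_path P \<and> has_colour c k P \<and> path_verts P = A"
proof -
  define P where "P = \<lparr>len = \<infinity>, vertex = enumerate A, forward = \<lambda>_. True\<rparr>"
  have inj: "inj (enumerate A)" and range: "range (enumerate A) = A"
    using bij_enumerate[OF assms(1)] by (auto simp: bij_betw_def)
  have verts: "path_verts P = A" by (simp add: P_def path_verts_def range)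
  have edge: "path_edge P i = (enumerate A i, enumerate A (Suc i))" for i
    by (simp add: P_def path_edge_def)
  have in_A: "enumerate A i \<in> A" for i using range by blast
  have neq: "enumerate A i \<noteq> enumerate A (Suc i)" for i using inj by (simp add: inj_eq)
  have "path_edges P \<subseteq> K_edges"
    using in_A neq assms(2) by (auto simp: path_edges_def edge K_edges_def)
  then have "is_directed_path P"
    using verts assms(2) inj by (simp add: is_directed_path_def is_path_def P_def)
  moreover have "has_colour c k P"
    using clique in_A neq by (auto simp: has_colour_def path_edges_def edge)
  ultimately show ?thesis using verts by blast
qed

theorem theorem1p3:
  fixes r :: nat and c :: "nat \<times> nat \<Rightarrow> colour"
  assumes "r > 0"
    and "\<not> (\<exists>P. is_directed_path P \<and> has_colour c Red P \<and> len P = enat r)"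
  shows "\<exists>P. is_directed_path P \<and> has_colour c Blue P \<and>
             upper_density (path_verts P) \<ge> ereal (1 / real r)"
proof -
  define E where "E = {e \<in> K_edges. c e = Red}"
  have "\<not> (\<exists>p. inj_on p {..r} \<and> (\<forall>i<r. (p i, p (Suc i)) \<in> E))"
  proof
    assume "\<exists>p. inj_on p {..r} \<and> (\<forall>i<r. (p i, p (Suc i)) \<in> E)"
    then obtain p where inj: "inj_on p {..r}" and p: "\<And>i. i < r \<Longrightarrow> (p i, p (Suc i)) \<in> E"
      by blast
    define P where "P = \<lparr>len = enat r, vertex = p, forward = \<lambda>_. True\<rparr>"
    have edges: "path_edges P \<subseteq> E"
      using p by (auto simp: P_def path_edges_def path_edge_def)
    have "p i \<in> K_verts" if "i \<le> r" for i
    proof (cases i)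
      case 0
      then show ?thesis using p[of 0] assms(1) by (simp add: E_def K_edges_def)
    next
      case (Suc j)
      then show ?thesis using p[of j] that by (simp add: E_def K_edges_def)
    qed
    then have "path_verts P \<subseteq> K_verts" by (auto simp: P_def path_verts_def)
    moreover have "inj_on (vertex P) {i. enat i \<le> len P}"
      using inj by (simp add: P_def atMost_def)
    ultimately have "is_directed_path P"
      using edges by (auto simp: is_directed_path_def is_path_def P_def E_def)
    moreover have "has_colour c Red P" using edges by (auto simp: has_colour_def E_def)
    moreover have "len P = enat r" by (simp add: P_def)
    ultimately show False using assms(2) by blast
  qed
  from gallai_roy[OF this] obtain f
    where f: "\<And>v. f v < r" and proper: "\<And>u v. (u, v) \<in> E \<Longrightarrow> u \<noteq> v \<Longrightarrow> f u \<noteq> f v"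
    by auto
  define A where "A i = {v \<in> K_verts. f v = i}" for i
  have "K_verts \<subseteq> (\<Union>i\<in>{..<r}. A i)" using f by (auto simp: A_def)
  from upper_density_pigeonhole[OF _ this] obtain i
    where dense: "upper_density (A i) \<ge> ereal (1 / real r)" by auto
  then have "infinite (A i)" using upper_density_finite[of "A i"] assms(1) by auto
  moreover have "A i \<subseteq> K_verts" by (auto simp: A_def)
  moreover have "c (u, v) = Blue" if "u \<in> A i" "v \<in> A i" "u \<noteq> v" for u v
    using that proper[of u v] by (cases "c (u, v)") (auto simp: A_def E_def K_edges_def)
  ultimately obtain P where "is_directed_path P" "has_colour c Blue P" "path_verts P = A i"
    using infinite_clique_path[of "A i" c Blue] by blast
  then show ?thesis using dense by auto
qed

end
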